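(* Let $G$ be a finite triangle-free unpinched graph. Then at least one of the following holds: (1) There exists a vertex $v \in G$ such that $G \setminus \{v\}$ is unpinched. (2) There exists an induced subgraph $K \leq G$ such that (i) $K$ separates $G$; and (ii) there exists a partition $G \setminus K = \bigsqcup_{i=1}^p G_i$ with $p \geq 2$, each $G_i$ non-empty, and no edge of $G$ between $G_i$ and $G_j$ for $i \neq j$, such that the subgraph induced by $G_i \cup K$ is unpinched for every $i$. (3) $G$ is a cycle of length $\geq 4$.
   Context: Graphs are simple. A graph is unpinched if it is neither complete nor separated by a clique (i.e. there is no complete subgraph $C$, possibly empty, such that removing $C$ leaves a disconnected graph); in particular an unpinched graph is connected. A subgraph $H \leq G$ is induced if two vertices of $H$ are adjacent in $H$ if and only if they are adjacent in $G$; a set of vertices is identified with the subgraph it induces. An induced subgraph $K$ separates $G$ if $G \setminus K$ is disconnected. *)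

theory Defs
  imports "Graph_Theory.Graph_Theory" "HOL-Library.Disjoint_Sets"
begin

text \<open>
  A finite simple graph is a digraph satisfying the library predicate \<^const>\<open>graph\<close>: finite,
  loopfree, without parallel arcs and symmetric, so that an undirected edge is a pair of
  opposite arcs. A set of vertices stands for the subgraph it induces.
\<close>

definition complete_graph :: "('a,'b) pre_digraph \<Rightarrow> bool" where
  "complete_graph G \<longleftrightarrow> complete_digraph (card (verts G)) G"

text \<open>
  In the library the null graph is not \<^const>\<open>connected\<close>; we do not count it as disconnected.
\<close>

definition disconnected :: "('a,'b) pre_digraph \<Rightarrow> bool" where
  "disconnected G \<longleftrightarrow> verts G \<noteq> {} \<and> \<not> connected G"

definition separates :: "('a,'b) pre_digraph \<Rightarrow> 'a set \<Rightarrow> bool" where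
  "separates G K \<longleftrightarrow> K \<subseteq> verts G \<and> disconnected (G \<restriction> (verts G - K))"

definition unpinched :: "('a,'b) pre_digraph \<Rightarrow> bool" where
  "unpinched G \<longleftrightarrow>
     \<not> complete_graph G \<and> \<not> (\<exists>C \<subseteq> verts G. complete_graph (G \<restriction> C) \<and> separates G C)"

definition triangle_free :: "('a,'b) pre_digraph \<Rightarrow> bool" where
  "triangle_free G \<longleftrightarrow>
     \<not> (\<exists>x y z. x \<noteq> y \<and> y \<noteq> z \<and> z \<noteq> x \<and> x \<rightarrow>\<^bsub>G\<^esub> y \<and> y \<rightarrow>\<^bsub>G\<^esub> z \<and> z \<rightarrow>\<^bsub>G\<^esub> x)"

text \<open>
  A directed cycle that passes through all vertices and uses one of the two arcs of every edge.
  The bound excludes the walk back and forth along a single edge, which is a cycle in the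
  sense of the library.
\<close>

definition cycle_graph :: "nat \<Rightarrow> ('a,'b) pre_digraph \<Rightarrow> bool" where
  "cycle_graph n G \<longleftrightarrow> graph G \<and> 3 \<le> n \<and>
     (\<exists>p. pre_digraph.cycle G p \<and> length p = n \<and> verts G = tail G ` set p \<and>
          arcs_ends G = arc_to_ends G ` set p \<union> (arc_to_ends G ` set p)\<inverse>)"

end

theory Submission
  imports Defs
begin

text \<open>
  The engine is a gluing principle: an induced path that leaves an unpinched induced subgraph \<open>H\<close> and
  comes back to it can be added to \<open>H\<close>. For a clique meets an induced path in at most two vertices,
  which are consecutive, so when it is removed, what is left of the path still hangs on to one of its
  ends, and hence to the connected rest of \<open>H\<close> (\<open>unpinched_on_add_path\<close>). The same idea shows that
  induced cycles of length at least four, or holes, are unpinched (\<open>unpinched_on_hole\<close>), and a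
  triangle-free unpinched graph contains one (\<open>unpinched_on_contains_hole\<close>).

  If \<open>G\<close> is not itself a hole, let \<open>H\<close> be a largest proper unpinched induced subgraph. As no clique of
  \<open>H\<close> separates \<open>G\<close>, some path outside \<open>H\<close> joins two nonadjacent vertices of \<open>H\<close>; take a
  shortest such ear, with ends \<open>a\<close> and \<open>b\<close>. By the gluing principle and maximality, \<open>G\<close> is the union
  of \<open>H\<close> and the ear. If the ear has a single inner vertex, deleting that vertex leaves \<open>H\<close>.

  Otherwise the minimality of the ear and the absence of triangles restrict the other edges between
  the ear and \<open>H\<close> severely: the set \<open>N\<close> of their ends in \<open>H\<close>, apart from \<open>a\<close> and \<open>b\<close>, is a clique
  whose members are adjacent to both \<open>a\<close> and \<open>b\<close>. Therefore \<open>H - N\<close> is connected and contains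
  an induced path from \<open>a\<close> to \<open>b\<close>, which closes the ear to a hole \<open>Z\<close>; and \<open>Z \<union> N\<close> is unpinched.
  If \<open>Z \<union> N\<close> is not everything, \<open>G\<close> is the union of the unpinched proper subgraphs \<open>H\<close> and
  \<open>Z \<union> N\<close> without edges between the two differences, which is the second alternative with
  \<open>K = H \<inter> (Z \<union> N)\<close>. If \<open>G = Z \<union> N\<close>, then either \<open>N\<close> is empty and \<open>G\<close> is the
  cycle \<open>Z\<close>, or any vertex of \<open>N\<close> can be deleted.
\<close>

section \<open>Unpinched vertex sets\<close>

context graph
begin

lemma dominates_sym: "u \<rightarrow> v \<Longrightarrow> v \<rightarrow> u"
  by (rule arcs_ends_symmetric[OF sym_arcs])

lemma dominates_commute: "u \<rightarrow> v \<longleftrightarrow> v \<rightarrow> u"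
  by (auto intro: dominates_sym)

lemma dominates_induce_iff: "u \<rightarrow>\<^bsub>G \<restriction> S\<^esub> v \<longleftrightarrow> u \<in> S \<and> v \<in> S \<and> u \<rightarrow> v"
  by (auto simp: arcs_ends_conv)

lemma reachable_in_refl: "x \<in> S \<Longrightarrow> x \<rightarrow>\<^sup>*\<^bsub>G \<restriction> S\<^esub> x"
  by (simp add: wf_digraph.reachable_refl[OF wellformed_induce_subgraph])

lemma reachable_in_trans:
  "x \<rightarrow>\<^sup>*\<^bsub>G \<restriction> S\<^esub> y \<Longrightarrow> y \<rightarrow>\<^sup>*\<^bsub>G \<restriction> S\<^esub> z \<Longrightarrow> x \<rightarrow>\<^sup>*\<^bsub>G \<restriction> S\<^esub> z"
  by (rule wf_digraph.reachable_trans[OF wellformed_induce_subgraph])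

lemma reachable_in_adj: "x \<in> S \<Longrightarrow> y \<in> S \<Longrightarrow> x \<rightarrow> y \<Longrightarrow> x \<rightarrow>\<^sup>*\<^bsub>G \<restriction> S\<^esub> y"
  by (rule wf_digraph.reachable_adjI[OF wellformed_induce_subgraph])
    (simp add: dominates_induce_iff)

lemma symmetric_induce: "symmetric (G \<restriction> S)"
  unfolding symmetric_def by (rule symI) (auto simp: dominates_induce_iff intro: dominates_sym)

lemma reachable_in_sym: "x \<rightarrow>\<^sup>*\<^bsub>G \<restriction> S\<^esub> y \<Longrightarrow> y \<rightarrow>\<^sup>*\<^bsub>G \<restriction> S\<^esub> x"
  by (rule symmetric_reachable[OF symmetric_induce])

lemma reachable_in_members: "x \<rightarrow>\<^sup>*\<^bsub>G \<restriction> S\<^esub> y \<Longrightarrow> x \<in> S \<and> y \<in> S"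
  by (auto elim: reachable_in_vertsE)

definition clique :: "'a set \<Rightarrow> bool" where
  "clique C \<longleftrightarrow> (\<forall>x\<in>C. \<forall>y\<in>C. x \<noteq> y \<longrightarrow> x \<rightarrow> y)"

text \<open>
  The next predicates describe induced subgraphs by their vertex sets, so that unions and
  differences can be formed freely. The empty set is connected in this sense, in accordance with
  \<^const>\<open>disconnected\<close>.
\<close>

definition connected_on :: "'a set \<Rightarrow> bool" where
  "connected_on S \<longleftrightarrow> (\<forall>x\<in>S. \<forall>y\<in>S. x \<rightarrow>\<^sup>*\<^bsub>G \<restriction> S\<^esub> y)"

definition unpinched_on :: "'a set \<Rightarrow> bool" where
  "unpinched_on S \<longleftrightarrow> \<not> clique S \<and> (\<forall>C\<subseteq>S. clique C \<longrightarrow> connected_on (S - C))"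

lemma graph_induce:
  assumes "S \<subseteq> verts G"
  shows "graph (G \<restriction> S)"
proof -
  interpret I: digraph "G \<restriction> S"
    using assms by (intro digraphI_induced induced_induce)
  show ?thesis by (rule I.graphI[OF symmetric_induce])
qed

lemma complete_induce_iff:
  assumes "C \<subseteq> verts G"
  shows "complete_graph (G \<restriction> C) \<longleftrightarrow> clique C"
proof -
  have "arcs_ends (G \<restriction> C) = {(u, v). (u, v) \<in> C \<times> C \<and> u \<noteq> v} \<longleftrightarrow> clique C"
    by (auto simp: clique_def set_eq_iff dominates_induce_iff dest: adj_not_same)
  then show ?thesis
    using graph_induce[OF assms] by (simp add: complete_graph_def complete_digraph_def)
qed

lemma disconnected_induce_iff: "disconnected (G \<restriction> S) \<longleftrightarrow> \<not> connected_on S"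
proof -
  interpret I: wf_digraph "G \<restriction> S" by (rule wellformed_induce_subgraph)
  have "connected (G \<restriction> S) \<longleftrightarrow> strongly_connected (G \<restriction> S)"
  proof
    show "connected (G \<restriction> S) \<Longrightarrow> strongly_connected (G \<restriction> S)"
      by (rule I.symmetric_connected_imp_strongly_connected[OF symmetric_induce])
    assume "strongly_connected (G \<restriction> S)"
    then show "connected (G \<restriction> S)"
      unfolding connected_def strongly_connected_def
      using I.reachable_mk_symmetricI by auto
  qed
  then show ?thesis
    by (auto simp: disconnected_def connected_on_def strongly_connected_def)
qed

lemma induce_induce: "C \<subseteq> S \<Longrightarrow> (G \<restriction> S) \<restriction> C = G \<restriction> C"
  by (auto simp: induce_subgraph_def)

lemma unpinched_induce_iff:
  assumes "S \<subseteq> verts G"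
  shows "unpinched (G \<restriction> S) \<longleftrightarrow> unpinched_on S"
proof -
  have "(complete_graph ((G \<restriction> S) \<restriction> C) \<and> separates (G \<restriction> S) C) \<longleftrightarrow> (clique C \<and> \<not> connected_on (S - C))"
    if "C \<subseteq> S" for C
    using that assms complete_induce_iff[of C]
    by (auto simp: separates_def induce_induce disconnected_induce_iff)
  then show ?thesis
    using complete_induce_iff[OF assms] by (auto simp: unpinched_def unpinched_on_def)
qed

lemma induce_verts: "G \<restriction> verts G = G"
  by (rule pre_digraph.equality) auto

lemma del_vert_induce: "del_vert v = G \<restriction> (verts G - {v})"
  by (rule pre_digraph.equality) (auto simp: del_vert_def)

section \<open>Walks and induced paths\<close>

definition walk :: "'a list \<Rightarrow> bool" where
  "walk xs \<longleftrightarrow> xs \<noteq> [] \<and> successively (dominates G) xs"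

definition induced_path :: "'a list \<Rightarrow> bool" where
  "induced_path xs \<longleftrightarrow> walk xs \<and> distinct xs \<and>
     (\<forall>i j. i < j \<and> j < length xs \<and> xs ! i \<rightarrow> xs ! j \<longrightarrow> j = Suc i)"

lemma walk_reachable_hd:
  assumes "walk xs" "set xs \<subseteq> S" "x \<in> set xs"
  shows "hd xs \<rightarrow>\<^sup>*\<^bsub>G \<restriction> S\<^esub> x"
  using assms
proof (induction xs)
  case (Cons y ys)
  show ?case
  proof (cases "x = y")
    case True
    with Cons show ?thesis by (auto intro: reachable_in_refl)
  next
    case False
    with Cons have "ys \<noteq> []" "x \<in> set ys" by auto
    with Cons have "hd ys \<rightarrow>\<^sup>*\<^bsub>G \<restriction> S\<^esub> x" "y \<rightarrow> hd ys"
      by (auto simp: walk_def successively_Cons)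
    moreover from this Cons.prems \<open>ys \<noteq> []\<close> have "y \<rightarrow>\<^sup>*\<^bsub>G \<restriction> S\<^esub> hd ys"
      by (intro reachable_in_adj) auto
    ultimately show ?thesis by (simp add: reachable_in_trans)
  qed
qed simp

lemma walk_reachable:
  assumes "walk xs" "set xs \<subseteq> S" "x \<in> set xs" "y \<in> set xs"
  shows "x \<rightarrow>\<^sup>*\<^bsub>G \<restriction> S\<^esub> y"
  using reachable_in_sym[OF walk_reachable_hd[OF assms(1-3)]] walk_reachable_hd[OF assms(1,2,4)]
  by (rule reachable_in_trans)

lemma reachable_walk:
  assumes "x \<rightarrow>\<^sup>*\<^bsub>G \<restriction> S\<^esub> y"
  obtains xs where "walk xs" "set xs \<subseteq> S" "hd xs = x" "last xs = y"
proof -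
  have "\<exists>xs. walk xs \<and> set xs \<subseteq> S \<and> hd xs = x \<and> last xs = y"
    using assms
  proof (induction rule: wf_digraph.converse_reachable_induct[OF wellformed_induce_subgraph,
        consumes 1, case_names base step])
    case base
    then show ?case by (intro exI[of _ "[y]"]) (auto simp: walk_def)
  next
    case (step x z)
    then obtain xs where "walk xs" "set xs \<subseteq> S" "hd xs = z" "last xs = y" by blast
    with step(1) show ?case
      by (intro exI[of _ "x # xs"]) (auto simp: walk_def successively_Cons dominates_induce_iff)
  qed
  then show thesis using that by blast
qed

lemma walk_take: "walk xs \<Longrightarrow> 0 < i \<Longrightarrow> walk (take i xs)"
  by (auto simp: walk_def successively_conv_nth)

lemma walk_drop: "walk xs \<Longrightarrow> i < length xs \<Longrightarrow> walk (drop i xs)"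
  by (auto simp: walk_def successively_conv_nth)

lemma walk_append:
  "walk xs \<Longrightarrow> walk ys \<Longrightarrow> last xs \<rightarrow> hd ys \<Longrightarrow> walk (xs @ ys)"
  by (auto simp: walk_def successively_append_iff)

lemma walk_rev: "walk (rev xs) \<longleftrightarrow> walk xs"
  unfolding walk_def successively_rev by (simp add: successively_conv_nth dominates_commute)

text \<open>
  A repeated vertex or a chord would give a shortcut. The competitors use only vertices of the walk
  itself, so the lemma also applies to walks that are shortest under a restriction on their vertices.
\<close>

lemma shortest_walk_induced_path:
  assumes w: "walk xs"
    and shortest: "\<And>ys. walk ys \<Longrightarrow> hd ys = hd xs \<Longrightarrow> last ys = last xs \<Longrightarrow>
                    set ys \<subseteq> set xs \<Longrightarrow> length xs \<le> length ys"
  shows "induced_path xs"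
proof -
  have "xs ! i \<noteq> xs ! j" if "i < j" "j < length xs" for i j
  proof
    assume eq: "xs ! i = xs ! j"
    define ys where "ys = take i xs @ drop j xs"
    have "hd ys = hd xs"
      using that eq w by (cases "i = 0") (auto simp: ys_def walk_def hd_drop_conv_nth hd_conv_nth hd_append)
    moreover have "walk ys"
    proof (cases "i = 0")
      case True
      then show ?thesis using w that by (simp add: ys_def walk_drop)
    next
      case False
      then obtain k where k: "i = Suc k" by (cases i) auto
      have "last (take i xs) = xs ! k" using that k by (simp add: last_conv_nth take_Suc_conv_app_nth)
      moreover have "xs ! k \<rightarrow> xs ! i" using w that k by (auto simp: walk_def successively_conv_nth)
      ultimately show ?thesis
        unfolding ys_def using False that w eq
        by (intro walk_append walk_take walk_drop) (auto simp: hd_drop_conv_nth)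
    qed
    moreover have "last ys = last xs" using that by (simp add: ys_def)
    moreover have "set ys \<subseteq> set xs" by (auto simp: ys_def dest: in_set_takeD in_set_dropD)
    ultimately have "length xs \<le> length ys" by (intro shortest)
    then show False using that by (simp add: ys_def)
  qed
  then have d: "distinct xs" by (metis distinct_conv_nth nat_neq_iff)
  have "j = Suc i" if "i < j" "j < length xs" "xs ! i \<rightarrow> xs ! j" for i j
  proof (rule ccontr)
    assume ne: "j \<noteq> Suc i"
    define ys where "ys = take (Suc i) xs @ drop j xs"
    have "last (take (Suc i) xs) = xs ! i" using that by (simp add: take_Suc_conv_app_nth)
    then have "walk ys"
      unfolding ys_def using that w
      by (intro walk_append walk_take walk_drop) (auto simp: hd_drop_conv_nth)
    moreover have "hd ys = hd xs" using that by (cases xs) (auto simp: ys_def)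
    moreover have "last ys = last xs" using that by (simp add: ys_def)
    moreover have "set ys \<subseteq> set xs" by (auto simp: ys_def dest: in_set_takeD in_set_dropD)
    ultimately have "length xs \<le> length ys" by (intro shortest)
    then show False using that ne by (simp add: ys_def)
  qed
  with d w show ?thesis by (auto simp: induced_path_def)
qed

lemma ex_shortest:
  fixes P :: "'c list \<Rightarrow> bool"
  assumes "P xs"
  obtains ys where "P ys" "\<And>zs. P zs \<Longrightarrow> length ys \<le> length zs"
  using ex_has_least_nat[of P xs length] assms by blast

lemma connected_on_induced_path:
  assumes "connected_on S" "a \<in> S" "b \<in> S"
  obtains xs where "induced_path xs" "set xs \<subseteq> S" "hd xs = a" "last xs = b"
proof -
  let ?P = "\<lambda>xs. walk xs \<and> set xs \<subseteq> S \<and> hd xs = a \<and> last xs = b"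
  obtain ws where "?P ws"
    using assms reachable_walk[where x = a and y = b and S = S] unfolding connected_on_def by blast
  then obtain xs where xs: "?P xs" and "\<And>zs. ?P zs \<Longrightarrow> length xs \<le> length zs"
    by (rule ex_shortest[of ?P]) blast
  then have "induced_path xs" by (intro shortest_walk_induced_path) auto
  with xs that show thesis by blast
qed

lemma induced_path_ends:
  assumes "induced_path xs" "hd xs \<noteq> last xs" "\<not> hd xs \<rightarrow> last xs"
  shows "3 \<le> length xs"
proof -
  have "xs \<noteq> []" "successively (dominates G) xs" using assms by (auto simp: induced_path_def walk_def)
  then show ?thesis
    using assms(2,3) by (cases xs rule: remdups_adj.cases) (auto simp: Suc_le_eq split: if_splits)
qed

text \<open>
  A clique contains at most two vertices of an induced path, and these are consecutive. So it cannot
  meet the path both before and after a vertex \<open>x\<close> that it misses, and the part of the path on the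
  free side links \<open>x\<close> to an end.
\<close>

lemma induced_path_reaches_end:
  assumes xs: "induced_path xs" and C: "clique C" and x: "x \<in> set xs - C"
  obtains e where "e \<in> {hd xs, last xs} - C" "x \<rightarrow>\<^sup>*\<^bsub>G \<restriction> (set xs - C)\<^esub> e"
proof -
  obtain i where i: "i < length xs" "xs ! i = x" using x by (auto simp: in_set_conv_nth)
  have w: "walk xs" using xs by (simp add: induced_path_def)
  have ne: "xs \<noteq> []" using i by auto
  show thesis
  proof (cases "set (take (Suc i) xs) \<inter> C = {}")
    case True
    then have "set (take (Suc i) xs) \<subseteq> set xs - C" by (auto dest: in_set_takeD)
    moreover have "hd xs \<in> set (take (Suc i) xs)" using ne by (cases xs) auto
    moreover have "x \<in> set (take (Suc i) xs)" using i by (auto simp: take_Suc_conv_app_nth)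
    ultimately show thesis
      using that[of "hd xs"] walk_reachable[OF walk_take[OF w, of "Suc i"]] by auto
  next
    case False
    then obtain j where j: "j < Suc i" "j < length xs" "xs ! j \<in> C"
      by (auto simp: in_set_conv_nth)
    with x i have "j < i" by (cases "j = i") auto
    have "set (drop i xs) \<inter> C = {}"
    proof (rule ccontr)
      assume "set (drop i xs) \<inter> C \<noteq> {}"
      then obtain y where "y \<in> set (drop i xs)" "y \<in> C" by auto
      then obtain k where "k < length (drop i xs)" "drop i xs ! k \<in> C"
        unfolding in_set_conv_nth by blast
      then have k: "i + k < length xs" "xs ! (i + k) \<in> C" by auto
      with x i have "k \<noteq> 0" by (cases k) auto
      have "xs ! j \<noteq> xs ! (i + k)"
        using xs k j \<open>j < i\<close> by (auto simp: induced_path_def nth_eq_iff_index_eq)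
      then have "xs ! j \<rightarrow> xs ! (i + k)" using C j k by (auto simp: clique_def)
      then have "i + k = Suc j"
        using xs k \<open>j < i\<close> unfolding induced_path_def by (metis trans_less_add1)
      with \<open>j < i\<close> \<open>k \<noteq> 0\<close> show False by simp
    qed
    then have "set (drop i xs) \<subseteq> set xs - C" by (auto dest: in_set_dropD)
    moreover have "last xs \<in> set (drop i xs)"
      using i by (metis last_drop last_in_set drop_eq_Nil not_le)
    moreover have "x \<in> set (drop i xs)" using i by (metis Cons_nth_drop_Suc list.set_intros(1))
    ultimately show thesis
      using that[of "last xs"] walk_reachable[OF walk_drop[OF w i(1)]] by auto
  qed
qed

lemma clique_subset: "clique C \<Longrightarrow> B \<subseteq> C \<Longrightarrow> clique B"
  by (auto simp: clique_def)

section \<open>Gluing paths and vertices to unpinched sets\<close>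

text \<open>
  What a clique leaves of \<open>H\<close> is connected; so it is enough that every other remaining vertex is
  linked to it.
\<close>

lemma unpinched_on_extend:
  assumes H: "unpinched_on H" and HT: "H \<subseteq> T"
    and reach: "\<And>C x. C \<subseteq> T \<Longrightarrow> clique C \<Longrightarrow> x \<in> T - H - C \<Longrightarrow>
                  \<exists>y\<in>H - C. x \<rightarrow>\<^sup>*\<^bsub>G \<restriction> (T - C)\<^esub> y"
  shows "unpinched_on T"
proof -
  have "connected_on (T - C)" if C: "C \<subseteq> T" "clique C" for C
  proof -
    have "clique (H \<inter> C)" "H \<inter> C \<subseteq> H" using C by (auto intro: clique_subset)
    then have "connected_on (H - H \<inter> C)" using H by (auto simp: unpinched_on_def)
    then have HC: "x \<rightarrow>\<^sup>*\<^bsub>G \<restriction> (T - C)\<^esub> y" if "x \<in> H - C" "y \<in> H - C" for x y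
      using that HT by (auto simp: connected_on_def Diff_Int_distrib intro: reachable_induce_ss)
    have to_H: "\<exists>y\<in>H - C. x \<rightarrow>\<^sup>*\<^bsub>G \<restriction> (T - C)\<^esub> y" if "x \<in> T - C" for x
      using that reach[OF C, of x] reachable_in_refl[of x "T - C"] by (cases "x \<in> H") auto
    show ?thesis
      unfolding connected_on_def
    proof (intro ballI)
      fix x y assume "x \<in> T - C" "y \<in> T - C"
      then obtain x' y' where "x' \<in> H - C" "x \<rightarrow>\<^sup>*\<^bsub>G \<restriction> (T - C)\<^esub> x'" "y' \<in> H - C" "y \<rightarrow>\<^sup>*\<^bsub>G \<restriction> (T - C)\<^esub> y'"
        using to_H by meson
      then show "x \<rightarrow>\<^sup>*\<^bsub>G \<restriction> (T - C)\<^esub> y"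
        using HC[of x' y'] by (metis reachable_in_trans reachable_in_sym)
    qed
  qed
  moreover have "\<not> clique T" using H HT clique_subset by (auto simp: unpinched_on_def)
  ultimately show ?thesis by (auto simp: unpinched_on_def)
qed

lemma unpinched_on_add_path:
  assumes H: "unpinched_on H" and xs: "induced_path xs" and ends: "hd xs \<in> H" "last xs \<in> H"
  shows "unpinched_on (H \<union> set xs)"
proof (rule unpinched_on_extend[OF H])
  fix C x assume C: "clique C" and x: "x \<in> H \<union> set xs - H - C"
  then obtain e where e: "e \<in> {hd xs, last xs} - C" "x \<rightarrow>\<^sup>*\<^bsub>G \<restriction> (set xs - C)\<^esub> e"
    using induced_path_reaches_end[OF xs C] by blast
  have "x \<rightarrow>\<^sup>*\<^bsub>G \<restriction> (H \<union> set xs - C)\<^esub> e" by (rule reachable_induce_ss[OF e(2)]) auto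
  with e ends show "\<exists>y\<in>H - C. x \<rightarrow>\<^sup>*\<^bsub>G \<restriction> (H \<union> set xs - C)\<^esub> y" by blast
qed simp

text \<open>
  A clique misses \<open>a\<close> or \<open>b\<close>, so each new vertex keeps a neighbour in \<open>H\<close>.
\<close>

lemma unpinched_on_add_common_neighbours:
  assumes H: "unpinched_on H" and ab: "a \<in> H" "b \<in> H" "a \<noteq> b" "\<not> a \<rightarrow> b"
    and N: "\<And>c. c \<in> N \<Longrightarrow> c \<rightarrow> a \<and> c \<rightarrow> b"
  shows "unpinched_on (H \<union> N)"
proof (rule unpinched_on_extend[OF H])
  fix C x assume C: "clique C" and x: "x \<in> H \<union> N - H - C"
  have "a \<notin> C \<or> b \<notin> C" using C ab by (auto simp: clique_def)
  then obtain e where "e \<in> {a, b}" "e \<notin> C" by blast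
  with x ab N show "\<exists>y\<in>H - C. x \<rightarrow>\<^sup>*\<^bsub>G \<restriction> (H \<union> N - C)\<^esub> y"
    by (auto intro!: bexI[of _ e] reachable_in_adj)
qed simp

section \<open>Holes\<close>

text \<open>
  An induced cycle of length at least four, cut into two arcs at nonadjacent vertices. This form
  fits the proof, in which cycles arise by joining two induced paths.
\<close>

definition hole :: "'a list \<Rightarrow> 'a list \<Rightarrow> bool" where
  "hole xs ys \<longleftrightarrow> induced_path xs \<and> induced_path ys \<and> hd xs = hd ys \<and> last xs = last ys \<and>
     hd xs \<noteq> last xs \<and> \<not> hd xs \<rightarrow> last xs \<and>
     (\<forall>x \<in> set xs - {hd xs, last xs}. \<forall>y \<in> set ys - {hd xs, last xs}. x \<noteq> y \<and> \<not> x \<rightarrow> y)"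

lemma walk_ends_in_set: "walk xs \<Longrightarrow> hd xs \<in> set xs \<and> last xs \<in> set xs"
  by (auto simp: walk_def)

text \<open>
  After the removal of a clique every remaining vertex reaches one of the two common ends \<open>a\<close>, \<open>b\<close>. If
  both of these survive, the clique lies in the interior of a single arc, because no edge joins the
  two interiors; the other arc then connects \<open>a\<close> with \<open>b\<close>.
\<close>

lemma unpinched_on_hole:
  assumes h: "hole xs ys"
  shows "unpinched_on (set xs \<union> set ys)"
proof -
  define a b T where "a = hd xs" and "b = last xs" and "T = set xs \<union> set ys"
  have p: "induced_path xs" "induced_path ys" and ends: "hd ys = a" "last ys = b"
    and ab: "a \<noteq> b" "\<not> a \<rightarrow> b"
    and apart: "\<And>x y. x \<in> set xs - {a, b} \<Longrightarrow> y \<in> set ys - {a, b} \<Longrightarrow> x \<noteq> y \<and> \<not> x \<rightarrow> y"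
    using h unfolding hole_def a_def b_def by metis+
  have w: "walk xs" "walk ys" using p by (auto simp: induced_path_def)
  have in_sets: "a \<in> set xs" "b \<in> set xs" "a \<in> set ys" "b \<in> set ys"
    using walk_ends_in_set[OF w(1)] walk_ends_in_set[OF w(2)] ends by (auto simp: a_def b_def)
  have "connected_on (T - C)" if C: "C \<subseteq> T" "clique C" for C
  proof -
    have to_end: "\<exists>e\<in>{a, b} - C. x \<rightarrow>\<^sup>*\<^bsub>G \<restriction> (T - C)\<^esub> e" if x: "x \<in> T - C" for x
    proof -
      from x consider "x \<in> set xs - C" | "x \<in> set ys - C" by (auto simp: T_def)
      then show ?thesis
      proof cases
        case 1
        then obtain e where e: "e \<in> {a, b} - C" "x \<rightarrow>\<^sup>*\<^bsub>G \<restriction> (set xs - C)\<^esub> e"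
          using induced_path_reaches_end[OF p(1) C(2)] unfolding a_def b_def by blast
        have "x \<rightarrow>\<^sup>*\<^bsub>G \<restriction> (T - C)\<^esub> e"
          by (rule reachable_induce_ss[OF e(2)]) (auto simp: T_def)
        with e(1) show ?thesis by blast
      next
        case 2
        then obtain e where e: "e \<in> {a, b} - C" "x \<rightarrow>\<^sup>*\<^bsub>G \<restriction> (set ys - C)\<^esub> e"
          using induced_path_reaches_end[OF p(2) C(2)] unfolding ends by blast
        have "x \<rightarrow>\<^sup>*\<^bsub>G \<restriction> (T - C)\<^esub> e"
          by (rule reachable_induce_ss[OF e(2)]) (auto simp: T_def)
        with e(1) show ?thesis by blast
      qed
    qed
    have across: "a \<rightarrow>\<^sup>*\<^bsub>G \<restriction> (T - C)\<^esub> b" if "a \<notin> C" "b \<notin> C"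
    proof (cases "set xs \<inter> C = {}")
      case True
      then show ?thesis
        using walk_reachable[OF w(1), of "T - C" a b] in_sets by (auto simp: T_def)
    next
      case False
      then obtain x where x: "x \<in> set xs" "x \<in> C" by auto
      have "set ys \<inter> C = {}"
      proof (rule ccontr)
        assume "set ys \<inter> C \<noteq> {}"
        then obtain y where y: "y \<in> set ys" "y \<in> C" by auto
        with x that have "x \<noteq> y \<and> \<not> x \<rightarrow> y" by (intro apart) auto
        with x y C show False by (auto simp: clique_def)
      qed
      then show ?thesis
        using walk_reachable[OF w(2), of "T - C" a b] in_sets by (auto simp: T_def)
    qed
    show ?thesis
      unfolding connected_on_def
    proof (intro ballI)
      fix x y assume "x \<in> T - C" "y \<in> T - C"
      then obtain d e where d: "d \<in> {a, b} - C" "x \<rightarrow>\<^sup>*\<^bsub>G \<restriction> (T - C)\<^esub> d"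
        and e: "e \<in> {a, b} - C" "y \<rightarrow>\<^sup>*\<^bsub>G \<restriction> (T - C)\<^esub> e"
        using to_end by meson
      then have "d \<rightarrow>\<^sup>*\<^bsub>G \<restriction> (T - C)\<^esub> e"
        using across reachable_in_sym[OF across] reachable_in_refl[of d "T - C"]
        by (auto dest: reachable_in_members)
      with d e show "x \<rightarrow>\<^sup>*\<^bsub>G \<restriction> (T - C)\<^esub> y"
        by (metis reachable_in_trans reachable_in_sym)
    qed
  qed
  moreover have "\<not> clique T" using in_sets ab by (auto simp: T_def clique_def)
  ultimately show ?thesis by (auto simp: unpinched_on_def T_def)
qed

text \<open>
  If the neighbours of \<open>x\<close> formed a clique, removing them would isolate \<open>x\<close>.
\<close>

lemma unpinched_on_nonadjacent_neighbours:
  assumes S: "unpinched_on S" and x: "x \<in> S"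
  obtains u w where "u \<in> S" "w \<in> S" "x \<rightarrow> u" "x \<rightarrow> w" "u \<noteq> w" "\<not> u \<rightarrow> w"
proof -
  define N where "N = {u \<in> S. x \<rightarrow> u}"
  have "\<not> clique N"
  proof
    assume N: "clique N"
    have xN: "x \<notin> N" using adj_not_same by (auto simp: N_def)
    have "connected_on (S - N)" using S N by (auto simp: unpinched_on_def N_def)
    have "y \<in> insert x N" if "y \<in> S" for y
    proof (rule ccontr)
      assume y: "y \<notin> insert x N"
      with that x xN \<open>connected_on (S - N)\<close> have "x \<rightarrow>\<^sup>*\<^bsub>G \<restriction> (S - N)\<^esub> y" by (auto simp: connected_on_def)
      then show False
        by (cases rule: pre_digraph.converse_reachable_cases) (use y in \<open>auto simp: dominates_induce_iff N_def\<close>)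
    qed
    moreover have "x \<rightarrow> y" "y \<rightarrow> x" if "y \<in> N" for y
      using that by (auto simp: N_def intro: dominates_sym)
    ultimately have "clique S" using N unfolding clique_def by (metis insert_iff)
    with S show False by (simp add: unpinched_on_def)
  qed
  with that show thesis by (auto simp: clique_def N_def)
qed

text \<open>
  Removing a single vertex \<open>x\<close> does not disconnect \<open>S\<close>, so two neighbours of \<open>x\<close> are joined by a walk
  that avoids \<open>x\<close>. In a shortest walk between two different neighbours no inner vertex is adjacent
  to \<open>x\<close>, hence \<open>x\<close> closes it to a hole; its ends are nonadjacent because there are no triangles.
\<close>

lemma unpinched_on_contains_hole:
  assumes tf: "triangle_free G" and S: "unpinched_on S"
  obtains xs ys where "hole xs ys" "set xs \<union> set ys \<subseteq> S"
proof -
  have "S \<noteq> {}" using S by (auto simp: unpinched_on_def clique_def)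
  then obtain x where x: "x \<in> S" by auto
  obtain u w where uw: "u \<in> S" "w \<in> S" "x \<rightarrow> u" "x \<rightarrow> w" "u \<noteq> w" "\<not> u \<rightarrow> w"
    using unpinched_on_nonadjacent_neighbours[OF S x] .
  let ?P = "\<lambda>zs. walk zs \<and> set zs \<subseteq> S - {x} \<and> x \<rightarrow> hd zs \<and> x \<rightarrow> last zs \<and> hd zs \<noteq> last zs"
  have "clique {x}" by (simp add: clique_def)
  then have "connected_on (S - {x})" using S x by (auto simp: unpinched_on_def)
  moreover have "u \<in> S - {x}" "w \<in> S - {x}" using uw adj_not_same by auto
  ultimately obtain ws where "induced_path ws" "set ws \<subseteq> S - {x}" "hd ws = u" "last ws = w"
    by (rule connected_on_induced_path)
  then have "?P ws" using uw by (auto simp: induced_path_def)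
  then obtain zs where zs: "?P zs" and least: "\<And>vs. ?P vs \<Longrightarrow> length zs \<le> length vs"
    by (rule ex_shortest[of ?P]) blast
  have ip: "induced_path zs"
    using zs least by (intro shortest_walk_induced_path) auto
  have nonadj: "\<not> hd zs \<rightarrow> last zs"
  proof
    assume "hd zs \<rightarrow> last zs"
    then show False
      using tf zs unfolding triangle_free_def by (metis dominates_sym adj_not_same)
  qed
  have inner: "\<not> x \<rightarrow> y" if y: "y \<in> set zs - {hd zs, last zs}" for y
  proof
    assume xy: "x \<rightarrow> y"
    obtain i where i: "i < length zs" "zs ! i = y" using y by (auto simp: in_set_conv_nth)
    have "zs \<noteq> []" using i by auto
    with y i have "Suc i \<noteq> length zs"
      by (metis DiffE diff_Suc_1 insertCI last_conv_nth)
    let ?v = "take (Suc i) zs"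
    have "hd ?v = hd zs" using \<open>zs \<noteq> []\<close> by (cases zs) auto
    moreover have "last ?v = y" using i by (simp add: take_Suc_conv_app_nth)
    moreover have "set ?v \<subseteq> set zs" by (auto dest: in_set_takeD)
    ultimately have "?P ?v"
      using zs xy y by (auto intro: walk_take)
    from least[OF this] \<open>Suc i \<noteq> length zs\<close> i show False by simp
  qed
  define xs where "xs = [hd zs, x, last zs]"
  have "walk xs" using zs by (auto simp: xs_def walk_def intro: dominates_sym)
  moreover have "distinct xs" using zs walk_ends_in_set[of zs] by (auto simp: xs_def)
  moreover have "j = Suc i" if "i < j" "j < length xs" "xs ! i \<rightarrow> xs ! j" for i j
  proof -
    from that have "i = 0 \<and> j = 1 \<or> i = 0 \<and> j = 2 \<or> i = 1 \<and> j = 2" by (auto simp: xs_def)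
    with that nonadj show ?thesis by (auto simp: xs_def)
  qed
  ultimately have "induced_path xs" by (auto simp: induced_path_def)
  moreover have "hd xs = hd zs" "last xs = last zs" "set xs = {hd zs, x, last zs}"
    by (auto simp: xs_def)
  ultimately have "hole xs zs" using ip nonadj inner zs by (auto simp: hole_def)
  moreover have "set xs \<union> set zs \<subseteq> S"
    using zs x walk_ends_in_set[of zs] by (auto simp: xs_def)
  ultimately show thesis by (rule that)
qed

section \<open>Ears\<close>

text \<open>
  If the neighbours in \<open>H\<close> of a component of \<open>V - H\<close> formed a clique, they would not be all of \<open>H\<close>
  and would separate the component from the rest of \<open>H\<close>. So two of them are nonadjacent, and a walk
  through the component joins these two. The walk is only required to avoid the rest of \<open>H\<close>, and may
  revisit its ends: in this form the condition passes to all shortcuts, and a shortest such walk is a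
  path.
\<close>

lemma exists_ear:
  assumes V: "unpinched_on V" and H: "H \<subset> V" "\<not> clique H"
  obtains xs where "walk xs" "hd xs \<in> H" "last xs \<in> H" "hd xs \<noteq> last xs" "\<not> hd xs \<rightarrow> last xs"
    "set xs \<subseteq> (V - H) \<union> {hd xs, last xs}"
proof -
  obtain d where d: "d \<in> V - H" using H by auto
  define R where "R = {y. d \<rightarrow>\<^sup>*\<^bsub>G \<restriction> (V - H)\<^esub> y}"
  define N where "N = {h \<in> H. \<exists>y\<in>R. y \<rightarrow> h}"
  have "\<not> clique N"
  proof
    assume N: "clique N"
    have "N \<subseteq> H" by (auto simp: N_def)
    have "connected_on (V - N)" using V N H \<open>N \<subseteq> H\<close> by (auto simp: unpinched_on_def)
    obtain h where h: "h \<in> H - N" using H N \<open>N \<subseteq> H\<close> clique_subset[of N H] by blast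
    have "d \<rightarrow>\<^sup>*\<^bsub>G \<restriction> (V - N)\<^esub> h"
      using \<open>connected_on (V - N)\<close> d h H \<open>N \<subseteq> H\<close> by (auto simp: connected_on_def)
    then have "h \<in> R"
    proof (induction rule: wf_digraph.reachable_induct[OF wellformed_induce_subgraph,
          consumes 1, case_names base step])
      case base
      then show ?case using d by (auto simp: R_def intro: reachable_in_refl)
    next
      case (step y z)
      then have yz: "y \<rightarrow> z" "z \<in> V" "z \<notin> N" by (auto simp: dominates_induce_iff)
      with step have "z \<in> V - H" by (auto simp: N_def)
      moreover have "y \<in> V - H" using step by (auto simp: R_def dest: reachable_in_members)
      ultimately have "y \<rightarrow>\<^sup>*\<^bsub>G \<restriction> (V - H)\<^esub> z" using yz by (intro reachable_in_adj)
      with step show ?case unfolding R_def mem_Collect_eq by (blast intro: reachable_in_trans)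
    qed
    with h show False by (auto simp: R_def dest: reachable_in_members)
  qed
  then obtain a b where ab: "a \<in> N" "b \<in> N" "a \<noteq> b" "\<not> a \<rightarrow> b" by (auto simp: clique_def)
  then obtain p q where pq: "p \<in> R" "p \<rightarrow> a" "q \<in> R" "q \<rightarrow> b" by (auto simp: N_def)
  then have "p \<rightarrow>\<^sup>*\<^bsub>G \<restriction> (V - H)\<^esub> q"
    unfolding R_def mem_Collect_eq by (metis reachable_in_trans reachable_in_sym)
  then obtain ws where ws: "walk ws" "set ws \<subseteq> V - H" "hd ws = p" "last ws = q"
    by (rule reachable_walk)
  have "walk ((([a] @ ws)) @ [b])"
    using ws pq by (intro walk_append) (auto simp: walk_def intro: dominates_sym)
  then show thesis
    using ab ws by (intro that[of "([a] @ ws) @ [b]"]) (auto simp: N_def)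
qed

lemma hole_length: "hole xs ys \<Longrightarrow> 3 \<le> length xs \<and> 3 \<le> length ys"
  unfolding hole_def by (metis induced_path_ends)

section \<open>Holes as cycles of the graph\<close>

lemma induced_path_rev:
  assumes xs: "induced_path xs"
  shows "induced_path (rev xs)"
proof -
  have "j = Suc i" if ij: "i < j" "j < length xs" "rev xs ! i \<rightarrow> rev xs ! j" for i j
  proof -
    have "xs ! (length xs - Suc j) \<rightarrow> xs ! (length xs - Suc i)"
      using ij by (simp add: rev_nth dominates_commute)
    moreover have "length xs - Suc j < length xs - Suc i" "length xs - Suc i < length xs"
      using ij by auto
    ultimately have "length xs - Suc i = Suc (length xs - Suc j)"
      using xs by (auto simp: induced_path_def)
    with ij show ?thesis by simp
  qed
  with xs show ?thesis by (auto simp: induced_path_def walk_rev)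
qed

lemma walk_awalk:
  assumes "walk xs" "set xs \<subseteq> verts G"
  obtains p where "awalk (hd xs) p (last xs)" "awalk_verts (hd xs) p = xs"
    "\<And>i. Suc i < length xs \<Longrightarrow> (xs ! i, xs ! Suc i) \<in> arc_to_ends G ` set p"
proof -
  have "\<exists>p. awalk (hd xs) p (last xs) \<and> awalk_verts (hd xs) p = xs \<and>
          (\<forall>i. Suc i < length xs \<longrightarrow> (xs ! i, xs ! Suc i) \<in> arc_to_ends G ` set p)"
    using assms
  proof (induction xs)
    case (Cons x xs)
    show ?case
    proof (cases "xs = []")
      case True
      with Cons show ?thesis by (intro exI[of _ "[]"]) (auto simp: awalk_Nil_iff)
    next
      case False
      with Cons have "walk xs" "set xs \<subseteq> verts G" "x \<rightarrow> hd xs"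
        by (auto simp: walk_def successively_Cons)
      with Cons.IH obtain p where p: "awalk (hd xs) p (last xs)" "awalk_verts (hd xs) p = xs"
          "\<And>i. Suc i < length xs \<Longrightarrow> (xs ! i, xs ! Suc i) \<in> arc_to_ends G ` set p"
        by blast
      obtain e where e: "e \<in> arcs G" "tail G e = x" "head G e = hd xs"
        using \<open>x \<rightarrow> hd xs\<close> by auto
      have "((x # xs) ! i, (x # xs) ! Suc i) \<in> arc_to_ends G ` set (e # p)"
        if "Suc i < length (x # xs)" for i
        using that p(3)[of "i - 1"] e False
        by (cases i) (auto simp: arc_to_ends_def hd_conv_nth)
      with p e False show ?thesis
        by (intro exI[of _ "e # p"]) (auto simp: awalk_Cons_iff)
    qed
  qed (simp add: walk_def)
  then show thesis using that by blast
qed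

lemma induced_path_edge:
  assumes xs: "induced_path xs" and uv: "u \<in> set xs" "v \<in> set xs" "u \<rightarrow> v"
  obtains i where "Suc i < length xs" "{u, v} = {xs ! i, xs ! Suc i}"
proof -
  obtain i j where ij: "i < length xs" "j < length xs" "u = xs ! i" "v = xs ! j"
    using uv by (auto simp: in_set_conv_nth)
  consider "i < j" | "j < i" | "i = j" by linarith
  then show thesis
  proof cases
    case 1
    with ij uv xs have "j = Suc i" by (auto simp: induced_path_def)
    with ij that[of i] show thesis by auto
  next
    case 2
    have "v \<rightarrow> u" using uv by (simp add: dominates_commute)
    with 2 ij xs have "i = Suc j" by (auto simp: induced_path_def)
    with ij that[of j] show thesis by auto
  next
    case 3
    with ij uv adj_not_same show thesis by auto
  qed
qed

lemma induced_path_arcs: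
  assumes xs: "induced_path xs" and sub: "set xs \<subseteq> verts G"
  obtains p where "awalk (hd xs) p (last xs)" "awalk_verts (hd xs) p = xs"
    "\<And>u v. u \<in> set xs \<Longrightarrow> v \<in> set xs \<Longrightarrow> u \<rightarrow> v \<Longrightarrow>
       (u, v) \<in> arc_to_ends G ` set p \<union> (arc_to_ends G ` set p)\<inverse>"
proof -
  have "walk xs" using xs by (simp add: induced_path_def)
  then obtain p where p: "awalk (hd xs) p (last xs)" "awalk_verts (hd xs) p = xs"
    "\<And>i. Suc i < length xs \<Longrightarrow> (xs ! i, xs ! Suc i) \<in> arc_to_ends G ` set p"
    using walk_awalk[OF _ sub] by blast
  have "(u, v) \<in> arc_to_ends G ` set p \<union> (arc_to_ends G ` set p)\<inverse>"
    if uv: "u \<in> set xs" "v \<in> set xs" "u \<rightarrow> v" for u v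
  proof -
    obtain i where "Suc i < length xs" "{u, v} = {xs ! i, xs ! Suc i}"
      using induced_path_edge[OF xs uv] .
    with p(3)[of i] show ?thesis by (auto simp: doubleton_eq_iff)
  qed
  with p that show thesis by blast
qed

text \<open>
  The closed walk runs along \<open>xs\<close> and back along \<open>ys\<close>. Each edge of the graph lies on one of the two
  paths, being induced, since no edge joins their interiors.
\<close>

lemma hole_cycle_graph:
  assumes h: "hole xs ys" and V: "verts G = set xs \<union> set ys"
  shows "cycle_graph (length xs + length ys - 2) G"
proof -
  define a b where "a = hd xs" and "b = last xs"
  have xs: "induced_path xs" and ys: "induced_path ys"
    and ends: "hd xs = a" "last xs = b" "hd ys = a" "last ys = b"
    and apart: "\<And>x y. x \<in> set xs - {a, b} \<Longrightarrow> y \<in> set ys - {a, b} \<Longrightarrow> x \<noteq> y \<and> \<not> x \<rightarrow> y"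
    using h unfolding hole_def a_def b_def by metis+
  have w: "walk xs" "walk ys" using xs ys by (auto simp: induced_path_def)
  have len: "3 \<le> length xs" "3 \<le> length ys" using hole_length[OF h] by auto
  have ne: "xs \<noteq> []" "ys \<noteq> []" using len by auto
  have in_sets: "a \<in> set xs" "b \<in> set xs" "a \<in> set ys" "b \<in> set ys"
    using walk_ends_in_set[OF w(1)] walk_ends_in_set[OF w(2)] ends by auto
  have rev_ends: "hd (rev ys) = b" "last (rev ys) = a"
    using ne ends by (auto simp: hd_rev last_rev)
  obtain p where p: "awalk a p b" "awalk_verts a p = xs"
    "\<And>u v. u \<in> set xs \<Longrightarrow> v \<in> set xs \<Longrightarrow> u \<rightarrow> v \<Longrightarrow>
       (u, v) \<in> arc_to_ends G ` set p \<union> (arc_to_ends G ` set p)\<inverse>"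
    using induced_path_arcs[OF xs] V ends by (metis Un_upper1)
  obtain q where q: "awalk b q a" "awalk_verts b q = rev ys"
    "\<And>u v. u \<in> set ys \<Longrightarrow> v \<in> set ys \<Longrightarrow> u \<rightarrow> v \<Longrightarrow>
       (u, v) \<in> arc_to_ends G ` set q \<union> (arc_to_ends G ` set q)\<inverse>"
    using induced_path_arcs[OF induced_path_rev[OF ys]] V rev_ends by (metis Un_upper2 set_rev)
  have pq: "awalk a (p @ q) a" using p q by auto
  have verts_pq: "awalk_verts a (p @ q) = xs @ tl (rev ys)"
    using awalk_verts_append[OF pq] p(2) q(2) ends(2) by simp
  have dist: "distinct xs" "distinct (rev ys)" using xs ys by (auto simp: induced_path_def)
  have "set (tl xs) \<inter> set (tl (rev ys)) = {}"
  proof (rule ccontr)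
    assume "set (tl xs) \<inter> set (tl (rev ys)) \<noteq> {}"
    then obtain z where z: "z \<in> set (tl xs)" "z \<in> set (tl (rev ys))" by auto
    have "z \<noteq> a" using z(1) dist(1) ends ne by (cases xs) auto
    moreover have "z \<noteq> b" using z(2) dist(2) rev_ends ne by (cases "rev ys") auto
    moreover have "z \<in> set xs" using z(1) by (rule list.set_sel(2)[OF ne(1)])
    moreover have "z \<in> set ys" using z(2) list.set_sel(2)[of "rev ys"] ne by auto
    ultimately show False using apart[of z z] by auto
  qed
  then have "distinct (tl (xs @ tl (rev ys)))" using dist ne by (simp add: distinct_tl)
  moreover have "length (p @ q) = length xs + length ys - 2"
    using length_awalk_verts[of a p] length_awalk_verts[of b q] p q by auto
  moreover from this len have "p @ q \<noteq> []" by auto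
  ultimately have cyc: "cycle (p @ q)" using pq verts_pq by (auto simp: cycle_def)
  have tails: "map (tail G) p = butlast xs" "map (tail G) q = butlast (rev ys)"
    using awalk_verts_conv[of a p] awalk_verts_conv[of b q] p q len
    by (auto split: if_splits)
  have "verts G \<subseteq> set (butlast xs) \<union> set (butlast (rev ys))"
  proof
    fix z assume "z \<in> verts G"
    then consider "z \<in> set (butlast xs)" | "z = b" | "z \<in> set (butlast (rev ys))" | "z = a"
      using V ends rev_ends ne
      by (metis Un_iff append_butlast_last_id in_set_conv_decomp rotate1.simps(2) set_ConsD set_append set_rev set_rotate1 rev_is_Nil_conv)
    moreover have "b \<in> set (butlast (rev ys))"
      using rev_ends len by (cases "rev ys" rule: remdups_adj.cases) auto
    moreover have "a \<in> set (butlast xs)"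
      using ends len by (cases xs rule: remdups_adj.cases) auto
    ultimately show "z \<in> set (butlast xs) \<union> set (butlast (rev ys))" by cases auto
  qed
  moreover have "set (tl ys) \<subseteq> set ys" by (cases ys) auto
  ultimately have "verts G = set (butlast xs) \<union> set (butlast (rev ys))"
    using V by (auto dest: in_set_butlastD)
  then have tail_verts: "verts G = tail G ` set (p @ q)"
    unfolding tails[symmetric] by (simp add: image_Un)
  let ?E = "arc_to_ends G ` set (p @ q)"
  have "set (p @ q) \<subseteq> arcs G" using pq by (auto simp: awalk_def)
  then have sub: "?E \<subseteq> arcs_ends G" by (auto simp: arcs_ends_def)
  have "arcs_ends G = ?E \<union> ?E\<inverse>"
  proof
    show "?E \<union> ?E\<inverse> \<subseteq> arcs_ends G" using sub by (auto intro: dominates_sym)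
    show "arcs_ends G \<subseteq> ?E \<union> ?E\<inverse>"
    proof (rule subrelI)
      fix u v assume uv: "u \<rightarrow> v"
      then have "u \<in> set xs \<union> set ys" "v \<in> set xs \<union> set ys" using V adj_in_verts by auto
      moreover have "\<not> (u \<in> set xs - set ys \<and> v \<in> set ys - set xs)"
        using apart[of u v] uv in_sets by auto
      moreover have "\<not> (v \<in> set xs - set ys \<and> u \<in> set ys - set xs)"
        using apart[of v u] uv in_sets by (auto simp: dominates_commute)
      ultimately consider "u \<in> set xs" "v \<in> set xs" | "u \<in> set ys" "v \<in> set ys" by auto
      then show "(u, v) \<in> ?E \<union> ?E\<inverse>"
      proof cases
        case 1
        from p(3)[OF this uv] show ?thesis by auto
      next
        case 2
        from q(3)[OF this uv] show ?thesis by auto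
      qed
    qed
  qed
  moreover have "graph G" by unfold_locales
  ultimately show ?thesis
    using cyc tail_verts \<open>length (p @ q) = length xs + length ys - 2\<close> len
    unfolding cycle_graph_def by (intro conjI exI[of _ "p @ q"]) auto
qed

section \<open>The three alternatives\<close>

text \<open>
  In the second alternative \<open>H\<close> and \<open>H'\<close> are the two sides \<open>G_i \<union> K\<close>, and \<open>K\<close> is their intersection.
\<close>

lemma unpinched_trichotomy [consumes 3, case_names delete union hole]:
  assumes tf: "triangle_free G" and fin: "finite V" and V: "unpinched_on V"
  obtains (delete) v where "v \<in> V" "unpinched_on (V - {v})"
    | (union) H H' where "unpinched_on H" "unpinched_on H'" "H \<subset> V" "H' \<subset> V" "H \<union> H' = V"
        "\<And>x y. x \<in> V - H \<Longrightarrow> y \<in> V - H' \<Longrightarrow> \<not> x \<rightarrow> y"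
    | (hole) xs ys where "hole xs ys" "V = set xs \<union> set ys"
proof -
  have triangle: "\<not> u \<rightarrow> w" if "u \<rightarrow> v" "v \<rightarrow> w" for u v w
  proof
    assume "u \<rightarrow> w"
    with that tf show False
      unfolding triangle_free_def by (metis dominates_sym adj_not_same)
  qed
  obtain xs0 ys0 where hole0: "hole xs0 ys0" "set xs0 \<union> set ys0 \<subseteq> V"
    using unpinched_on_contains_hole[OF tf V] .
  show thesis
  proof (cases "set xs0 \<union> set ys0 = V")
    case True
    with hole0 show thesis by (intro hole) auto
  next
    case False
    let ?P = "\<lambda>H. unpinched_on H \<and> H \<subset> V"
    have "?P (set xs0 \<union> set ys0)" using hole0 False unpinched_on_hole by auto
    moreover have "\<forall>H. ?P H \<longrightarrow> card H < Suc (card V)"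
      using fin by (auto intro!: le_imp_less_Suc card_mono)
    ultimately have "\<exists>H. ?P H \<and> (\<forall>H'. ?P H' \<longrightarrow> card H' \<le> card H)"
      by (rule ex_has_greatest_nat)
    then obtain H where H: "unpinched_on H" "H \<subset> V" and max: "\<And>H'. ?P H' \<Longrightarrow> card H' \<le> card H"
      by blast
    have "\<not> clique H" using H by (simp add: unpinched_on_def)
    define ear where "ear = (\<lambda>xs. walk xs \<and> hd xs \<in> H \<and> last xs \<in> H \<and> hd xs \<noteq> last xs \<and>
      \<not> hd xs \<rightarrow> last xs \<and> set xs \<subseteq> (V - H) \<union> {hd xs, last xs})"
    obtain ws where "ear ws"
      using exists_ear[OF V H(2) \<open>\<not> clique H\<close>] unfolding ear_def by metis
    then obtain xs where "ear xs" and shortest: "\<And>zs. ear zs \<Longrightarrow> length xs \<le> length zs"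
      by (rule ex_shortest) blast
    define a b n where "a = hd xs" and "b = last xs" and "n = length xs"
    have xs: "walk xs" "a \<in> H" "b \<in> H" "a \<noteq> b" "\<not> a \<rightarrow> b" "set xs \<subseteq> (V - H) \<union> {a, b}"
      using \<open>ear xs\<close> by (auto simp: ear_def a_def b_def)
    have ip: "induced_path xs"
      using xs shortest
      by (intro shortest_walk_induced_path) (auto simp: ear_def a_def b_def)
    have "3 \<le> n" using induced_path_ends[OF ip] xs by (auto simp: a_def b_def n_def)
    have "xs \<noteq> []" using xs by (simp add: walk_def)
    have nth_ends: "xs ! 0 = a" "xs ! (n - 1) = b"
      using \<open>xs \<noteq> []\<close> by (auto simp: a_def b_def n_def hd_conv_nth last_conv_nth)
    have distinct: "xs ! i = xs ! j \<longleftrightarrow> i = j" if "i < n" "j < n" for i j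
      using ip that by (auto simp: induced_path_def n_def nth_eq_iff_index_eq)
    have inner: "xs ! i \<in> V - H" if "0 < i" "i < n - 1" for i
    proof -
      have "xs ! i \<in> set xs" using that by (auto simp: n_def)
      moreover have "xs ! i \<noteq> a" "xs ! i \<noteq> b"
        using that distinct[of i 0] distinct[of i "n - 1"] nth_ends by auto
      ultimately show ?thesis using xs by auto
    qed
    have "unpinched_on (H \<union> set xs)" using unpinched_on_add_path[OF H(1) ip] xs by (simp add: a_def b_def)
    moreover have "H \<subset> H \<union> set xs"
    proof -
      have "xs ! 1 \<in> V - H" "xs ! 1 \<in> set xs" using inner[of 1] \<open>3 \<le> n\<close> by (auto simp: n_def)
      then show ?thesis by auto
    qed
    moreover have "H \<union> set xs \<subseteq> V" using H xs by auto
    ultimately have cover: "H \<union> set xs = V"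
      using max[of "H \<union> set xs"] fin
      by (metis finite_subset leD psubsetI psubset_card_mono)
    have outside: "\<exists>i. 0 < i \<and> i < n - 1 \<and> x = xs ! i" if x: "x \<in> V - H" for x
    proof -
      obtain i where i: "i < n" "x = xs ! i"
        using x cover by (auto simp: in_set_conv_nth n_def)
      moreover have "i \<noteq> 0" using x xs(2) i(2) nth_ends(1) by (cases "i = 0") auto
      moreover have "i \<noteq> n - 1" using x xs(3) i(2) nth_ends(2) by (cases "i = n - 1") auto
      ultimately show ?thesis by (intro exI[of _ i]) auto
    qed
    show thesis
    proof (cases "n = 3")
      case True
      have "V - {xs ! 1} = H"
        using H(2) inner[of 1] outside True by (auto simp: less_Suc_eq numeral_3_eq_3)
      then show thesis using delete[of "xs ! 1"] inner[of 1] True H(1) by auto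
    next
      case False
      with \<open>3 \<le> n\<close> have n: "4 \<le> n" by simp
      \<comment> \<open>Nonadjacent neighbours of two inner vertices are the ends of an ear, so the two inner
          vertices cannot be closer on \<open>xs\<close> than the first and the last one.\<close>
      have span: "n \<le> j - i + 3"
        if "0 < i" "i \<le> j" "j < n - 1" and c: "c \<in> H" "c' \<in> H" "c \<noteq> c'" "\<not> c \<rightarrow> c'"
          and "c \<rightarrow> xs ! i" "xs ! j \<rightarrow> c'" for i j c c'
      proof -
        define ys where "ys = take (j - i + 1) (drop i xs)"
        have len: "length ys = j - i + 1" using that by (simp add: ys_def n_def)
        then have "ys \<noteq> []" by auto
        have nth: "ys ! k = xs ! (i + k)" if "k < length ys" for k
          using that by (auto simp: ys_def intro: nth_drop)
        have "hd ys = xs ! i" using \<open>ys \<noteq> []\<close> nth[of 0] by (simp add: hd_conv_nth)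
        moreover have "last ys = xs ! j"
          using \<open>ys \<noteq> []\<close> nth[of "j - i"] len \<open>i \<le> j\<close> by (simp add: last_conv_nth)
        moreover have "walk ys"
          unfolding ys_def using that xs(1) by (intro walk_take walk_drop) (auto simp: n_def)
        ultimately have "walk (([c] @ ys) @ [c'])"
          using that \<open>ys \<noteq> []\<close> by (intro walk_append) (auto simp: walk_def)
        moreover have "set ys \<subseteq> V - H"
        proof
          fix y assume "y \<in> set ys"
          then obtain k where "k < length ys" "y = ys ! k" by (auto simp: in_set_conv_nth)
          then show "y \<in> V - H" using nth[of k] inner[of "i + k"] len that by auto
        qed
        ultimately have "ear (([c] @ ys) @ [c'])" using c by (auto simp: ear_def)
        from shortest[OF this] len show ?thesis by (simp add: n_def)
      qed
      have one_nbr: "c = c'"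
        if "0 < i" "i < n - 1" "c \<in> H" "c' \<in> H" "c \<rightarrow> xs ! i" "xs ! i \<rightarrow> c'" for i c c'
      proof (rule ccontr)
        assume "c \<noteq> c'"
        moreover have "\<not> c \<rightarrow> c'" using triangle that by blast
        ultimately show False using span[of i i c c'] that n by simp
      qed
      have steps: "a \<rightarrow> xs ! 1" "xs ! (n - 2) \<rightarrow> b"
      proof -
        have step: "xs ! i \<rightarrow> xs ! Suc i" if "Suc i < n" for i
          using xs(1) that by (auto simp: walk_def n_def successively_conv_nth)
        show "a \<rightarrow> xs ! 1" using step[of 0] n nth_ends by simp
        have "Suc (n - 2) = n - 1" using n by simp
        then show "xs ! (n - 2) \<rightarrow> b" using step[of "n - 2"] n nth_ends by simp
      qed
      define N where "N = {c \<in> H - {a, b}. \<exists>x\<in>V - H. x \<rightarrow> c}"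
      \<comment> \<open>The first and the last inner vertex have \<open>a\<close> and \<open>b\<close> as their only neighbours in \<open>H\<close>.\<close>
      have N_at: "\<exists>i. 1 < i \<and> i < n - 2 \<and> xs ! i \<rightarrow> c" if c: "c \<in> N" for c
      proof -
        obtain i where i: "0 < i" "i < n - 1" "xs ! i \<rightarrow> c" "c \<in> H" "c \<noteq> a" "c \<noteq> b"
          using c outside by (auto simp: N_def)
        moreover have "i \<noteq> 1" using one_nbr[of 1 a c] i steps xs by auto
        moreover have "i \<noteq> n - 2"
          using one_nbr[of "n - 2" c b] i steps xs n by (auto simp: dominates_commute)
        ultimately show ?thesis by (intro exI[of _ i]) auto
      qed
      \<comment> \<open>Otherwise \<open>c\<close> and \<open>a\<close>, or \<open>c\<close> and \<open>b\<close>, would be the ends of a shorter ear.\<close>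
      have N_adj: "c \<rightarrow> a \<and> c \<rightarrow> b" if c: "c \<in> N" for c
      proof -
        obtain i where i: "1 < i" "i < n - 2" "xs ! i \<rightarrow> c" using N_at[OF c] by auto
        have "c \<in> H" "c \<noteq> a" "c \<noteq> b" using c by (auto simp: N_def)
        then have "a \<rightarrow> c" using span[of 1 i a c] i steps xs by fastforce
        moreover have "c \<rightarrow> xs ! i" using i by (simp add: dominates_commute)
        then have "c \<rightarrow> b" using span[of i "n - 2" c b] i steps xs \<open>c \<in> H\<close> \<open>c \<noteq> b\<close> by fastforce
        ultimately show ?thesis by (simp add: dominates_commute)
      qed
      \<comment> \<open>Two different members of \<open>N\<close> would be nonadjacent, having the common neighbour \<open>a\<close>, and would again be
          the ends of a shorter ear. So \<open>N\<close> has at most one element.\<close>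
      have N_clique: "clique N"
      proof -
        have no: False
          if cc: "c \<in> N" "c' \<in> N" "c \<noteq> c'"
            and ij: "1 < i" "i \<le> j" "j < n - 2" "xs ! i \<rightarrow> c" "xs ! j \<rightarrow> c'" for c c' i j
        proof -
          have "\<not> c \<rightarrow> c'"
            using triangle[of c a c'] N_adj[OF cc(1)] N_adj[OF cc(2)] by (auto simp: dominates_commute)
          then have "n \<le> j - i + 3"
            using cc ij by (intro span[of i j c c']) (auto simp: N_def dominates_commute)
          with ij show False by simp
        qed
        have "c = c'" if cc: "c \<in> N" "c' \<in> N" for c c'
        proof (rule ccontr)
          assume "c \<noteq> c'"
          obtain i j where "1 < i" "i < n - 2" "xs ! i \<rightarrow> c" "1 < j" "j < n - 2" "xs ! j \<rightarrow> c'"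
            using N_at[OF cc(1)] N_at[OF cc(2)] by blast
          with \<open>c \<noteq> c'\<close> cc no[of c c' i j] no[of c' c j i] show False
            by (cases "i \<le> j") auto
        qed
        then show ?thesis by (auto simp: clique_def)
      qed
      have "N \<subseteq> H" by (auto simp: N_def)
      then have "connected_on (H - N)" using H(1) N_clique by (auto simp: unpinched_on_def)
      moreover have "a \<in> H - N" "b \<in> H - N" using xs by (auto simp: N_def)
      ultimately obtain ys where ys: "induced_path ys" "set ys \<subseteq> H - N" "hd ys = a" "last ys = b"
        by (rule connected_on_induced_path)
      have "hole xs ys"
        unfolding hole_def
      proof (intro conjI ballI)
        fix x y assume xy: "x \<in> set xs - {hd xs, last xs}" "y \<in> set ys - {hd xs, last xs}"
        then have x: "x \<in> V - H" and y: "y \<in> H - N - {a, b}"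
          using xs ys by (auto simp: a_def b_def)
        then show "x \<noteq> y" by auto
        show "\<not> x \<rightarrow> y" using x y by (auto simp: N_def)
      qed (use ip ys xs in \<open>auto simp: a_def b_def\<close>)
      define Z where "Z = set xs \<union> set ys"
      have "unpinched_on Z" using unpinched_on_hole[OF \<open>hole xs ys\<close>] by (simp add: Z_def)
      have abZ: "a \<in> Z" "b \<in> Z" using walk_ends_in_set[OF xs(1)] by (auto simp: Z_def a_def b_def)
      have add: "unpinched_on (Z \<union> M)" if "M \<subseteq> N" for M
        using that N_adj by (intro unpinched_on_add_common_neighbours[OF \<open>unpinched_on Z\<close> abZ xs(4,5)]) auto
      show thesis
      proof (cases "Z \<union> N = V")
        case False
        have "Z \<union> N \<subset> V" using False cover ys \<open>N \<subseteq> H\<close> H by (auto simp: Z_def)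
        moreover have "H \<union> (Z \<union> N) = V" using cover ys \<open>N \<subseteq> H\<close> by (auto simp: Z_def)
        moreover have "\<not> x \<rightarrow> y" if "x \<in> V - H" "y \<in> V - (Z \<union> N)" for x y
          using that abZ cover by (auto simp: N_def Z_def)
        ultimately show thesis using union[OF H(1) add[OF order_refl] H(2)] by blast
      next
        case True
        show thesis
        proof (cases "N = {}")
          case True
          with \<open>Z \<union> N = V\<close> \<open>hole xs ys\<close> show thesis by (intro hole) (auto simp: Z_def)
        next
          case False
          then obtain c where c: "c \<in> N" by auto
          have "c \<notin> Z" using c ys xs by (auto simp: Z_def N_def)
          then have "V - {c} = Z \<union> (N - {c})" using True by auto
          then show thesis using delete[of c] add[of "N - {c}"] c True by auto
        qed
      qed
    qed
  qed
qed

end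

theorem theorem6p2:
  fixes G :: "('a, 'b) pre_digraph"
  assumes "graph G"
    and "triangle_free G"
    and "unpinched G"
  shows "(\<exists>v \<in> verts G. unpinched (pre_digraph.del_vert G v))
    \<or> (\<exists>K. separates G K \<and>
         (\<exists>P. partition_on (verts G - K) P \<and> 2 \<le> card P \<and>
              (\<forall>A \<in> P. \<forall>B \<in> P. A \<noteq> B \<longrightarrow> \<not> (\<exists>a \<in> A. \<exists>b \<in> B. a \<rightarrow>\<^bsub>G\<^esub> b)) \<and>
              (\<forall>A \<in> P. unpinched (G \<restriction> (A \<union> K)))))
    \<or> (\<exists>n \<ge> 4. cycle_graph n G)"
proof -
  interpret graph G by fact
  have V: "unpinched_on (verts G)"
    using assms(3) unpinched_induce_iff[of "verts G"] by (simp add: induce_verts)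
  from assms(2) finite_verts V show ?thesis
  proof (cases rule: unpinched_trichotomy)
    case (delete v)
    then have "unpinched (del_vert v)" by (simp add: del_vert_induce unpinched_induce_iff)
    with delete show ?thesis by blast
  next
    case (union H H')
    define A B K where "A = verts G - H" and "B = verts G - H'" and "K = H \<inter> H'"
    have AB: "A \<noteq> {}" "B \<noteq> {}" "A \<inter> B = {}" and rest: "verts G - K = A \<union> B"
      using union by (auto simp: A_def B_def K_def)
    have sides: "A \<union> K = H'" "B \<union> K = H" using union by (auto simp: A_def B_def K_def)
    have no_edge: "\<not> x \<rightarrow>\<^bsub>G\<^esub> y" "\<not> y \<rightarrow>\<^bsub>G\<^esub> x" if "x \<in> A" "y \<in> B" for x y
      using that union by (auto simp: A_def B_def dominates_commute)
    have "\<not> connected_on (A \<union> B)"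
    proof
      assume conn: "connected_on (A \<union> B)"
      obtain x y where xy: "x \<in> A" "y \<in> B" using AB by auto
      with conn have "x \<rightarrow>\<^sup>*\<^bsub>G \<restriction> (A \<union> B)\<^esub> y" by (auto simp: connected_on_def)
      then have "y \<in> A"
        by (induction rule: wf_digraph.reachable_induct[OF wellformed_induce_subgraph,
              consumes 1, case_names base step])
          (use xy no_edge in \<open>auto simp: dominates_induce_iff\<close>)
      with xy AB show False by auto
    qed
    then have "separates G K"
      using union rest by (auto simp: separates_def disconnected_induce_iff K_def)
    moreover have "partition_on (verts G - K) {A, B}"
      using AB rest by (auto simp: partition_on_def disjoint_def)
    moreover have "2 \<le> card {A, B}" using AB by (cases "A = B") auto
    moreover have "\<forall>X\<in>{A, B}. \<forall>Y\<in>{A, B}. X \<noteq> Y \<longrightarrow> \<not> (\<exists>a\<in>X. \<exists>b\<in>Y. a \<rightarrow>\<^bsub>G\<^esub> b)"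
      using no_edge by auto
    moreover have "\<forall>X\<in>{A, B}. unpinched (G \<restriction> (X \<union> K))"
      using sides union by (auto simp: unpinched_induce_iff)
    ultimately show ?thesis by blast
  next
    case (hole xs ys)
    then have "cycle_graph (length xs + length ys - 2) G" by (intro hole_cycle_graph)
    moreover have "4 \<le> length xs + length ys - 2" using hole_length[OF hole(1)] by auto
    ultimately show ?thesis by blast
  qed
qed

end
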